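(* Let $\{E_1,\dots,E_{m-1}\}$ be a Clifford algebra on $\mathbb{R}^l$, i.e. $E_1,\dots,E_{m-1}\in O(l)$ are real skew-symmetric orthogonal matrices satisfying $E_iE_j+E_jE_i=-2\delta_{ij}I_l$ for all $i,j$. Let $B_1,\dots,B_M\in\mathrm{span}\{E_1,\dots,E_{m-1}\}$ (real span). Then $$\sum_{r,s=1}^M\|[B_r,B_s]\|^2\le\frac4l\left(1-\frac1N\right)\left(\sum_{r=1}^M\|B_r\|^2\right)^2,\qquad N=\min\{m-1,M\}.$$ The condition for equality has two cases. Case (1): When $m-1\le M$, equality holds if and only if $e_1,\dots,e_{m-1}$ are pairwise orthogonal with the same norm, where $e_i:=(\langle E_i,B_1\rangle,\dots,\langle E_i,B_M\rangle)\in\mathbb{R}^M$. Case (2): When $m-1\ge M$, equality holds if and only if $B_1,\dots,B_M$ are pairwise orthogonal with respect to $\langle\cdot,\cdot\rangle$ and have the same norm.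
   Context: $[A,B]=AB-BA$; for real matrices $\langle A,B\rangle=\mathrm{tr}(AB^t)$ is the Frobenius inner product and $\|A\|^2=\langle A,A\rangle$. $O(l)$ is the group of real orthogonal $l\times l$ matrices, $I_l$ the identity matrix, $\delta_{ij}$ the Kronecker delta. Here $l,M\ge 1$ and $m\ge 2$ are integers (so that the list $E_1,\dots,E_{m-1}$ is nonempty). *)

theory Defs
  imports "HOL-Analysis.Analysis"
begin

definition commutator :: "real^'l^'l \<Rightarrow> real^'l^'l \<Rightarrow> real^'l^'l" where
  "commutator A B = A ** B - B ** A"

definition frob_inner :: "real^'l^'l \<Rightarrow> real^'l^'l \<Rightarrow> real" where
  "frob_inner A B = trace (A ** transpose B)"

definition frob_norm :: "real^'l^'l \<Rightarrow> real" where
  "frob_norm A = sqrt (frob_inner A A)"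

lemma frob_inner_eq_inner: "frob_inner A B = A \<bullet> B"
  by (simp add: frob_inner_def trace_def matrix_matrix_mult_def transpose_def inner_vec_def)

lemma frob_norm_eq_norm: "frob_norm A = norm A"
  by (simp add: frob_norm_def frob_inner_eq_inner norm_eq_sqrt_inner)

text \<open>The family is \<open>E 1, \<dots>, E k\<close>; values of \<open>E\<close> at other indices are irrelevant.\<close>

definition clifford_algebra :: "nat \<Rightarrow> (nat \<Rightarrow> real^'l^'l) \<Rightarrow> bool" where
  "clifford_algebra k E \<longleftrightarrow>
     (\<forall>i\<in>{1..k}. orthogonal_matrix (E i) \<and> transpose (E i) = - E i) \<and>
     (\<forall>i\<in>{1..k}. \<forall>j\<in>{1..k}.
        E i ** E j + E j ** E i = (-2 * (if i = j then 1 else 0)) *\<^sub>R mat 1)"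

end

theory Submission
  imports Defs
begin

text \<open>Clifford elements satisfy \<open>A B + B A = -(2/l) \<langle>A,B\<rangle> I\<close>, which gives
  \<open>\<parallel>[A,B]\<parallel>\<^sup>2 = (4/l) (\<parallel>A\<parallel>\<^sup>2 \<parallel>B\<parallel>\<^sup>2 - \<langle>A,B\<rangle>\<^sup>2)\<close>. Both the estimate and the equality
  discussion are thus about the lower bound for the sum of the squared entries of a Gram matrix in
  terms of its trace. The matrix with entries \<open>\<langle>B\<^sub>r,B\<^sub>s\<rangle>\<close> and \<open>1/l\<close> times the Gram
  matrix of the \<open>e\<^sub>i\<close> have the same trace and the same Frobenius norm by Parseval, so the bound
  is available with either number of vectors.\<close>

section \<open>Gram matrices: trace against Frobenius norm\<close>

text \<open>The diagonal contributes the sum of the squares of \<open>a i = (norm (v i))^2\<close>;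
  Lagrange's identity for the vectors \<open>a\<close> and (1,...,1) turns its excess over the
  squared trace into squared differences. The defect is thus a sum of nonnegative terms, from which
  both the inequality and its equality case are read off.\<close>

lemma gram_defect:
  fixes v :: "'i \<Rightarrow> 'a::real_inner"
  assumes "finite I"
  shows "real (card I) * (\<Sum>i\<in>I. \<Sum>j\<in>I. (v i \<bullet> v j)\<^sup>2) - (\<Sum>i\<in>I. (norm (v i))\<^sup>2)\<^sup>2
    = real (card I) * (\<Sum>i\<in>I. \<Sum>j\<in>I - {i}. (v i \<bullet> v j)\<^sup>2)
      + (\<Sum>i\<in>I. \<Sum>j\<in>I. ((norm (v i))\<^sup>2 - (norm (v j))\<^sup>2)\<^sup>2) / 2"
proof -
  define a where "a i = (norm (v i))\<^sup>2" for i
  have "(\<Sum>j\<in>I. (v i \<bullet> v j)\<^sup>2) = (a i)\<^sup>2 + (\<Sum>j\<in>I - {i}. (v i \<bullet> v j)\<^sup>2)" if "i \<in> I" for i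
    using assms that by (simp add: sum.remove a_def power2_norm_eq_inner)
  then have split: "(\<Sum>i\<in>I. \<Sum>j\<in>I. (v i \<bullet> v j)\<^sup>2)
      = (\<Sum>i\<in>I. (a i)\<^sup>2) + (\<Sum>i\<in>I. \<Sum>j\<in>I - {i}. (v i \<bullet> v j)\<^sup>2)"
    by (simp add: sum.distrib)
  have "(\<Sum>i\<in>I. \<Sum>j\<in>I. (a i - a j)\<^sup>2)
      = (\<Sum>i\<in>I. \<Sum>j\<in>I. (a i)\<^sup>2) + (\<Sum>i\<in>I. \<Sum>j\<in>I. (a j)\<^sup>2) - 2 * (\<Sum>i\<in>I. \<Sum>j\<in>I. a i * a j)"
    by (simp add: power2_diff sum.distrib sum_subtractf sum_distrib_left mult.assoc)
  also have "\<dots> = 2 * real (card I) * (\<Sum>i\<in>I. (a i)\<^sup>2) - 2 * (\<Sum>i\<in>I. a i)\<^sup>2"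
    by (simp add: power2_eq_square[of "sum _ _"] sum_product sum_distrib_left[symmetric])
  finally show ?thesis
    unfolding split a_def[symmetric] by (simp add: algebra_simps)
qed

lemma gram_inequality:
  fixes v :: "'i \<Rightarrow> 'a::real_inner"
  assumes "finite I"
  shows "(\<Sum>i\<in>I. (norm (v i))\<^sup>2)\<^sup>2 \<le> real (card I) * (\<Sum>i\<in>I. \<Sum>j\<in>I. (v i \<bullet> v j)\<^sup>2)"
proof -
  have "0 \<le> real (card I) * (\<Sum>i\<in>I. \<Sum>j\<in>I - {i}. (v i \<bullet> v j)\<^sup>2)
      + (\<Sum>i\<in>I. \<Sum>j\<in>I. ((norm (v i))\<^sup>2 - (norm (v j))\<^sup>2)\<^sup>2) / 2"
    by (intro add_nonneg_nonneg mult_nonneg_nonneg divide_nonneg_nonneg sum_nonneg) auto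
  with gram_defect[OF assms, of v] show ?thesis by linarith
qed

lemma gram_equality_iff:
  fixes v :: "'i \<Rightarrow> 'a::real_inner"
  assumes "finite I"
  shows "(\<Sum>i\<in>I. (norm (v i))\<^sup>2)\<^sup>2 = real (card I) * (\<Sum>i\<in>I. \<Sum>j\<in>I. (v i \<bullet> v j)\<^sup>2) \<longleftrightarrow>
    (\<forall>i\<in>I. \<forall>j\<in>I. i \<noteq> j \<longrightarrow> orthogonal (v i) (v j)) \<and> (\<forall>i\<in>I. \<forall>j\<in>I. norm (v i) = norm (v j))"
proof -
  define P where "P = (\<Sum>i\<in>I. \<Sum>j\<in>I - {i}. (v i \<bullet> v j)\<^sup>2)"
  define Q where "Q = (\<Sum>i\<in>I. \<Sum>j\<in>I. ((norm (v i))\<^sup>2 - (norm (v j))\<^sup>2)\<^sup>2)"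
  have "0 \<le> P" "0 \<le> Q"
    unfolding P_def Q_def by (simp_all add: sum_nonneg)
  have "(\<Sum>i\<in>I. (norm (v i))\<^sup>2)\<^sup>2 = real (card I) * (\<Sum>i\<in>I. \<Sum>j\<in>I. (v i \<bullet> v j)\<^sup>2)
      \<longleftrightarrow> real (card I) * P + Q / 2 = 0"
    unfolding P_def Q_def gram_defect[OF assms, of v, symmetric] right_minus_eq by (rule eq_commute)
  also have "\<dots> \<longleftrightarrow> real (card I) * P = 0 \<and> Q = 0"
    using \<open>0 \<le> P\<close> \<open>0 \<le> Q\<close>
    by (auto simp: add_nonneg_eq_0_iff)
  \<comment> \<open>The factor can only vanish for empty \<open>I\<close>, and then \<open>P\<close>
    is an empty sum.\<close>
  also have "real (card I) * P = 0 \<longleftrightarrow> P = 0"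
    using assms by (auto simp: P_def)
  also have "P = 0 \<longleftrightarrow> (\<forall>i\<in>I. \<forall>j\<in>I. i \<noteq> j \<longrightarrow> orthogonal (v i) (v j))"
    using assms by (auto simp: P_def sum_nonneg_eq_0_iff sum_nonneg orthogonal_def)
  also have "Q = 0 \<longleftrightarrow> (\<forall>i\<in>I. \<forall>j\<in>I. norm (v i) = norm (v j))"
    using assms by (simp add: Q_def sum_nonneg_eq_0_iff sum_nonneg)
  finally show ?thesis .
qed

section \<open>Matrix products, traces and commutators of skew-symmetric matrices\<close>

lemma bounded_bilinear_matrix_mult:
  "bounded_bilinear ((**) :: real^'m^'n \<Rightarrow> real^'p^'m \<Rightarrow> real^'p^'n)"
  unfolding bilinear_conv_bounded_bilinear[symmetric] bilinear_def
  by (auto intro!: linearI simp: vec_eq_iff matrix_matrix_mult_def sum.distrib algebra_simps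
      sum_distrib_left)

lemmas matrix_mult_bilinear =
  bounded_bilinear.add_left[OF bounded_bilinear_matrix_mult]
  bounded_bilinear.add_right[OF bounded_bilinear_matrix_mult]
  bounded_bilinear.diff_left[OF bounded_bilinear_matrix_mult]
  bounded_bilinear.diff_right[OF bounded_bilinear_matrix_mult]
  bounded_bilinear.minus_left[OF bounded_bilinear_matrix_mult]
  bounded_bilinear.minus_right[OF bounded_bilinear_matrix_mult]
  bounded_bilinear.scaleR_left[OF bounded_bilinear_matrix_mult]
  bounded_bilinear.scaleR_right[OF bounded_bilinear_matrix_mult]

lemma transpose_add: "transpose (A + B) = transpose A + transpose (B :: 'a::ab_group_add^'n^'m)"
  by (simp add: transpose_def vec_eq_iff)

lemma transpose_diff: "transpose (A - B) = transpose A - transpose (B :: 'a::ab_group_add^'n^'m)"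
  by (simp add: transpose_def vec_eq_iff)

lemma trace_scaleR: "trace (c *\<^sub>R A) = c * trace (A :: real^'n^'n)"
  by (simp add: trace_def sum_distrib_left)

lemma inner_eq_trace_skew:
  fixes A B :: "real^'l^'l"
  assumes "transpose B = - B"
  shows "A \<bullet> B = - trace (A ** B)"
proof -
  have "A ** (- B) = - (A ** B)"
    by (simp add: matrix_mult_bilinear)
  then show ?thesis
    using assms by (simp add: frob_inner_eq_inner[symmetric] frob_inner_def trace_def sum_negf)
qed

text \<open>Take traces: \<open>A ** B\<close> and \<open>B ** A\<close> have the same trace, which
  is minus the inner product by skewness.\<close>

lemma anticommutator_scalar:
  fixes A B :: "real^'l^'l"
  assumes "transpose A = - A" "A ** B + B ** A = (- 2 * c) *\<^sub>R mat 1"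
  shows "A \<bullet> B = c * real CARD('l)"
proof -
  have "trace (A ** B) + trace (B ** A) = - 2 * c * real CARD('l)"
    using arg_cong[OF assms(2), of trace] by (simp only: trace_add trace_scaleR trace_I)
  then show ?thesis
    using inner_eq_trace_skew[OF assms(1), of B] trace_mul_sym[of A B]
    by (simp add: inner_commute)
qed

text \<open>With \<open>X = A ** B\<close> the commutator is twice \<open>X + c I\<close>. The
  relations give a quadratic equation for \<open>X\<close>, and completing the square makes
  \<open>C ** C\<close> a scalar matrix. As \<open>C\<close> is skew-symmetric, its squared norm is
  minus the trace of that matrix.\<close>

lemma norm_commutator_skew:
  fixes A B :: "real^'l^'l"
  assumes skew: "transpose A = - A" "transpose B = - B"
    and sq: "A ** A = (- a) *\<^sub>R mat 1" "B ** B = (- b) *\<^sub>R mat 1"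
    and anti: "A ** B + B ** A = (- 2 * c) *\<^sub>R mat 1"
  shows "(norm (commutator A B))\<^sup>2 = 4 * real CARD('l) * (a * b - c\<^sup>2)"
proof -
  define C where "C = commutator A B"
  define X where "X = A ** B"
  have BA: "B ** A = (- 2 * c) *\<^sub>R mat 1 - X"
    unfolding anti[symmetric] X_def by simp
  have C: "C = 2 *\<^sub>R X + (2 * c) *\<^sub>R mat 1"
    by (simp add: C_def commutator_def BA flip: X_def) (simp add: scaleR_2)
  \<comment> \<open>Regrouping exposes \<open>B ** A\<close>, so that the anticommutation relation
    moves the factors into \<open>A ** A\<close> and \<open>B ** B\<close>.\<close>
  have "X ** X = A ** (B ** A) ** B"
    by (simp add: X_def matrix_mul_assoc)
  also have "\<dots> = (- 2 * c) *\<^sub>R X - (A ** A) ** (B ** B)"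
    unfolding BA by (simp add: X_def matrix_mult_bilinear matrix_mul_assoc)
  also have "\<dots> = (- 2 * c) *\<^sub>R X - (a * b) *\<^sub>R mat 1"
    unfolding sq by (simp add: matrix_mult_bilinear)
  finally have XX: "X ** X = (- 2 * c) *\<^sub>R X - (a * b) *\<^sub>R mat 1" .
  have "C ** C = 4 *\<^sub>R (X ** X) + (8 * c) *\<^sub>R X + (4 * c\<^sup>2) *\<^sub>R mat 1"
    unfolding C by (simp add: matrix_mult_bilinear vec_eq_iff power2_eq_square algebra_simps)
  then have CC: "C ** C = (- 4 * (a * b - c\<^sup>2)) *\<^sub>R mat 1"
    unfolding XX by (simp add: algebra_simps)
  have "transpose C = - C"
    using skew by (simp add: C_def commutator_def transpose_diff matrix_transpose_mul
        matrix_mult_bilinear)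
  from inner_eq_trace_skew[OF this, of C] show ?thesis
    unfolding CC C_def[symmetric] power2_norm_eq_inner by (simp only: trace_scaleR trace_I)
      (simp add: algebra_simps)
qed

section \<open>The span of a Clifford algebra\<close>

lemma clifford_algebraD:
  assumes "clifford_algebra k E" "i \<in> {1..k}" "j \<in> {1..k}"
  shows "transpose (E i) = - E i"
    and "E i ** E j + E j ** E i = (- 2 * (if i = j then 1 else 0)) *\<^sub>R mat 1"
  using assms unfolding clifford_algebra_def by blast+

lemma clifford_inner:
  fixes E :: "nat \<Rightarrow> real^'l^'l"
  assumes "clifford_algebra k E" "i \<in> {1..k}" "j \<in> {1..k}"
  shows "E i \<bullet> E j = (if i = j then real CARD('l) else 0)"
  using anticommutator_scalar[OF clifford_algebraD[OF assms]] by simp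

lemma clifford_span_skew:
  fixes E :: "nat \<Rightarrow> real^'l^'l"
  assumes "clifford_algebra k E" "A \<in> span (E ` {1..k})"
  shows "transpose A = - A"
  using assms(2)
proof (induction rule: span_induct)
  case base
  show ?case
  proof (rule subspaceI)
    show "0 \<in> {A :: real^'l^'l. transpose A = - A}"
      by (simp add: transpose_def vec_eq_iff)
  qed (simp_all add: transpose_add transpose_scalar)
next
  case (step A)
  then show ?case
    using clifford_algebraD(1)[OF assms(1)] by blast
qed

text \<open>Both sides are bilinear in \<open>A\<close> and \<open>B\<close>, so it suffices to
  compare them on generators, where \<open>clifford_inner\<close> identifies the scalar in the
  Clifford relation.\<close>

lemma clifford_span_anticommutator:
  fixes E :: "nat \<Rightarrow> real^'l^'l"
  assumes cl: "clifford_algebra k E" and A: "A \<in> span (E ` {1..k})" and B: "B \<in> span (E ` {1..k})"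
  shows "A ** B + B ** A = (- 2 * ((A \<bullet> B) / real CARD('l))) *\<^sub>R mat 1"
proof -
  define P :: "real^'l^'l \<Rightarrow> real^'l^'l \<Rightarrow> bool"
    where "P A B \<longleftrightarrow> A ** B + B ** A = (- 2 * ((A \<bullet> B) / real CARD('l))) *\<^sub>R mat 1" for A B
  \<comment> \<open>By symmetry, linearity in the second argument serves for span induction in
    either argument.\<close>
  have sym: "P A B \<longleftrightarrow> P B A" for A B
    by (simp add: P_def inner_commute add.commute)
  have sub: "subspace (Collect (P A))" for A
  proof (rule subspaceI)
    show "0 \<in> Collect (P A)" by (simp add: P_def)
    show "x + y \<in> Collect (P A)" if "x \<in> Collect (P A)" "y \<in> Collect (P A)" for x y
    proof -
      have "A ** (x + y) + (x + y) ** A = (A ** x + x ** A) + (A ** y + y ** A)"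
        by (simp add: matrix_mult_bilinear)
      also have "\<dots> = (- 2 * ((A \<bullet> x) / real CARD('l)) + - 2 * ((A \<bullet> y) / real CARD('l))) *\<^sub>R mat 1"
        using that unfolding P_def mem_Collect_eq scaleR_add_left by simp
      finally show ?thesis
        by (simp add: P_def inner_add_right add_divide_distrib distrib_left)
    qed
    show "c *\<^sub>R x \<in> Collect (P A)" if "x \<in> Collect (P A)" for c x
    proof -
      have "A ** (c *\<^sub>R x) + (c *\<^sub>R x) ** A = c *\<^sub>R (A ** x + x ** A)"
        by (simp add: matrix_mult_bilinear scaleR_add_right)
      then show ?thesis
        using that by (simp add: P_def)
    qed
  qed
  have "P (E i) (E j)" if "i \<in> {1..k}" "j \<in> {1..k}" for i j
    unfolding P_def clifford_algebraD(2)[OF cl that] clifford_inner[OF cl that] by simp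
  then have "P B (E i)" if "i \<in> {1..k}" for i
    using span_induct[OF B sub[of "E i"]] that sym by blast
  then show ?thesis
    using span_induct[OF A sub[of B]] sym unfolding P_def by blast
qed

lemma clifford_span_norm_commutator:
  fixes E :: "nat \<Rightarrow> real^'l^'l"
  assumes cl: "clifford_algebra k E" and A: "A \<in> span (E ` {1..k})" and B: "B \<in> span (E ` {1..k})"
  shows "(norm (commutator A B))\<^sup>2
    = 4 / real CARD('l) * ((norm A)\<^sup>2 * (norm B)\<^sup>2 - (A \<bullet> B)\<^sup>2)"
proof -
  have sq: "X ** X = (- ((norm X)\<^sup>2 / real CARD('l))) *\<^sub>R mat 1" if "X \<in> span (E ` {1..k})" for X
  proof -
    \<comment> \<open>The anticommutator of \<open>X\<close> with itself is twice its
      square.\<close>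
    have "2 *\<^sub>R (X ** X) = 2 *\<^sub>R ((- ((norm X)\<^sup>2 / real CARD('l))) *\<^sub>R mat 1)"
      using clifford_span_anticommutator[OF cl that that]
      by (simp add: scaleR_2 power2_norm_eq_inner)
    then show ?thesis
      by (simp only: scaleR_cancel_left) simp
  qed
  have "(norm (commutator A B))\<^sup>2 = 4 * real CARD('l) *
      ((norm A)\<^sup>2 / real CARD('l) * ((norm B)\<^sup>2 / real CARD('l)) - (A \<bullet> B / real CARD('l))\<^sup>2)"
    by (intro norm_commutator_skew clifford_span_skew[OF cl] clifford_span_anticommutator[OF cl]
        sq A B)
  then show ?thesis
    by (simp add: divide_simps power2_eq_square)
qed

text \<open>By linearity \<open>A\<close> may be taken to be a generator \<open>E j\<close>;
  orthogonality then leaves only the term \<open>i = j\<close>. The factor \<open>CARD('l)\<close>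
  is the common squared norm of the generators.\<close>

lemma clifford_span_parseval:
  fixes E :: "nat \<Rightarrow> real^'l^'l"
  assumes cl: "clifford_algebra k E" and A: "A \<in> span (E ` {1..k})"
  shows "(\<Sum>i=1..k. (E i \<bullet> A) * (E i \<bullet> B)) = real CARD('l) * (A \<bullet> B)"
  using A
proof (induction rule: span_induct)
  case base
  show ?case
    by (rule subspaceI) (simp_all add: inner_add_left inner_add_right distrib_right distrib_left
        sum.distrib mult.assoc sum_distrib_left[symmetric])
next
  case (step A)
  then obtain j where j: "j \<in> {1..k}" "A = E j" by blast
  have "(\<Sum>i=1..k. (E i \<bullet> E j) * (E i \<bullet> B))
      = (\<Sum>i=1..k. if i = j then real CARD('l) * (E i \<bullet> B) else 0)"
    using clifford_inner[OF cl _ j(1)] by (intro sum.cong) auto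
  then show ?case
    using j by simp
qed

section \<open>The commutator inequality and its two equality cases\<close>

theorem theorem4p4:
  fixes m :: nat
    and E :: "nat \<Rightarrow> real^'l^'l"
    and B :: "'M::finite \<Rightarrow> real^'l^'l"
  assumes "m \<ge> 2"
    and "clifford_algebra (m - 1) E"
    and "\<And>r. B r \<in> span (E ` {1..m - 1})"
  shows
    "let N = min (m - 1) CARD('M);
         lhs = (\<Sum>r\<in>UNIV. \<Sum>s\<in>UNIV. (frob_norm (commutator (B r) (B s)))\<^sup>2);
         rhs = 4 / real CARD('l) * (1 - 1 / real N) * (\<Sum>r\<in>UNIV. (frob_norm (B r))\<^sup>2)\<^sup>2;
         e = (\<lambda>i. (\<chi> r. frob_inner (E i) (B r)) :: real^'M)
     in lhs \<le> rhs
      \<and> (m - 1 \<le> CARD('M) \<longrightarrow>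
           (lhs = rhs \<longleftrightarrow>
              (\<forall>i\<in>{1..m - 1}. \<forall>j\<in>{1..m - 1}. i \<noteq> j \<longrightarrow> orthogonal (e i) (e j)) \<and>
              (\<forall>i\<in>{1..m - 1}. \<forall>j\<in>{1..m - 1}. norm (e i) = norm (e j))))
      \<and> (m - 1 \<ge> CARD('M) \<longrightarrow>
           (lhs = rhs \<longleftrightarrow>
              (\<forall>r s. r \<noteq> s \<longrightarrow> frob_inner (B r) (B s) = 0) \<and>
              (\<forall>r s. frob_norm (B r) = frob_norm (B s))))"
proof -
  define k where "k = m - 1"
  define l where "l = real CARD('l)"
  define M where "M = CARD('M)"
  define e where "e i = (\<chi> r. frob_inner (E i) (B r) :: real^'M)" for i
  \<comment> \<open>\<open>T\<close> is the trace of the Gram matrix of the \<open>B r\<close>, and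
    \<open>G\<close> is its squared Frobenius norm.\<close>
  define T where "T = (\<Sum>r\<in>UNIV. (norm (B r))\<^sup>2)"
  define G where "G = (\<Sum>r\<in>UNIV. \<Sum>s\<in>UNIV. (B r \<bullet> B s)\<^sup>2)"
  define lhs where
    "lhs = (\<Sum>r\<in>UNIV. \<Sum>s\<in>UNIV. (frob_norm (commutator (B r) (B s)))\<^sup>2)"
  define rhs where
    "rhs N = 4 / real CARD('l) * (1 - 1 / real N) * (\<Sum>r\<in>UNIV. (frob_norm (B r))\<^sup>2)\<^sup>2" for N
  have "k > 0" "l > 0" "M > 0"
    using assms(1) by (simp_all add: k_def l_def M_def)
  have cl: "clifford_algebra k E" and span: "B r \<in> span (E ` {1..k})" for r
    using assms by (simp_all add: k_def)
  have "lhs = (\<Sum>r\<in>UNIV. \<Sum>s\<in>UNIV. 4 / l * ((norm (B r))\<^sup>2 * (norm (B s))\<^sup>2 - (B r \<bullet> B s)\<^sup>2))"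
    unfolding lhs_def l_def frob_norm_eq_norm clifford_span_norm_commutator[OF cl span span] ..
  also have "\<dots> = 4 / l * (T\<^sup>2 - G)"
    unfolding T_def G_def power2_eq_square[of "sum _ _"] sum_product sum_distrib_left[symmetric]
      sum_subtractf ..
  finally have lhs: "lhs = 4 / l * (T\<^sup>2 - G)" .
  have diff: "rhs N - lhs = 4 / (l * real N) * (real N * G - T\<^sup>2)" if "N > 0" for N
    using that \<open>l > 0\<close> unfolding lhs rhs_def T_def l_def[symmetric] frob_norm_eq_norm
    by (simp add: field_simps)
  \<comment> \<open>For every positive \<open>N\<close>, the bound and its equality case become the
    Gram estimate for \<open>N\<close> vectors with the same \<open>T\<close> and
    \<open>G\<close>.\<close>
  have le_iff: "lhs \<le> rhs N \<longleftrightarrow> T\<^sup>2 \<le> real N * G" and eq_iff: "lhs = rhs N \<longleftrightarrow> T\<^sup>2 = real N * G"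
    if "N > 0" for N
  proof -
    have pos: "4 / (l * real N) > 0"
      using that \<open>l > 0\<close> by simp
    have "lhs \<le> rhs N \<longleftrightarrow> 0 \<le> 4 / (l * real N) * (real N * G - T\<^sup>2)"
      unfolding diff[OF that, symmetric] by simp
    then show "lhs \<le> rhs N \<longleftrightarrow> T\<^sup>2 \<le> real N * G"
      using pos by (auto simp only: zero_le_mult_iff)
    have "lhs = rhs N \<longleftrightarrow> 4 / (l * real N) * (real N * G - T\<^sup>2) = 0"
      unfolding diff[OF that, symmetric] by auto
    then show "lhs = rhs N \<longleftrightarrow> T\<^sup>2 = real N * G"
      using pos by (auto simp only: mult_eq_0_iff)
  qed
  have e_inner: "e i \<bullet> e j = (\<Sum>r\<in>UNIV. (E i \<bullet> B r) * (E j \<bullet> B r))" for i j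
    by (simp add: e_def inner_vec_def frob_inner_eq_inner)
  have parseval: "l * (B r \<bullet> B s) = (\<Sum>i=1..k. (E i \<bullet> B r) * (E i \<bullet> B s))" for r s
    using clifford_span_parseval[OF cl span] by (simp add: l_def)
  \<comment> \<open>Parseval with equal indices, summed over \<open>r\<close>.\<close>
  have trace_e: "(\<Sum>i=1..k. (norm (e i))\<^sup>2) = l * T"
    unfolding T_def power2_norm_eq_inner e_inner sum_distrib_left parseval by (rule sum.swap)
  \<comment> \<open>Expand each inner product by Parseval and move the sums over \<open>i\<close>
    and \<open>j\<close> outside; the inner double sum over \<open>r\<close> and \<open>s\<close>
    then factors as the square of \<open>e i \<bullet> e j\<close>.\<close>
  have "l\<^sup>2 * G = (\<Sum>r\<in>UNIV. \<Sum>s\<in>UNIV. (l * (B r \<bullet> B s)) * (l * (B r \<bullet> B s)))"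
    by (simp add: G_def power2_eq_square sum_distrib_left mult_ac)
  also have "\<dots> = (\<Sum>r\<in>UNIV. \<Sum>s\<in>UNIV. \<Sum>i=1..k. \<Sum>j=1..k.
      (E i \<bullet> B r) * (E i \<bullet> B s) * ((E j \<bullet> B r) * (E j \<bullet> B s)))"
    unfolding parseval sum_product ..
  also have "\<dots> = (\<Sum>r\<in>UNIV. \<Sum>i=1..k. \<Sum>s\<in>UNIV. \<Sum>j=1..k.
      (E i \<bullet> B r) * (E i \<bullet> B s) * ((E j \<bullet> B r) * (E j \<bullet> B s)))"
    by (intro sum.cong refl sum.swap)
  also have "\<dots> = (\<Sum>i=1..k. \<Sum>r\<in>UNIV. \<Sum>j=1..k. \<Sum>s\<in>UNIV.
      (E i \<bullet> B r) * (E i \<bullet> B s) * ((E j \<bullet> B r) * (E j \<bullet> B s)))"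
    by (subst sum.swap) (intro sum.cong refl sum.swap)
  also have "\<dots> = (\<Sum>i=1..k. \<Sum>j=1..k. \<Sum>r\<in>UNIV. \<Sum>s\<in>UNIV.
      (E i \<bullet> B r) * (E i \<bullet> B s) * ((E j \<bullet> B r) * (E j \<bullet> B s)))"
    by (intro sum.cong refl sum.swap)
  also have "\<dots> = (\<Sum>i=1..k. \<Sum>j=1..k. (e i \<bullet> e j)\<^sup>2)"
    unfolding e_inner power2_eq_square sum_product by (simp add: mult_ac)
  finally have frob_e: "(\<Sum>i=1..k. \<Sum>j=1..k. (e i \<bullet> e j)\<^sup>2) = l\<^sup>2 * G" ..
  \<comment> \<open>Both sides of the Gram estimate for the \<open>e i\<close> carry the factor
    \<open>l^2\<close>, which cancels and leaves the estimate for \<open>T\<close> and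
    \<open>G\<close> with \<open>k\<close> in place of \<open>M\<close>.\<close>
  have gram_e: "(\<Sum>i=1..k. (norm (e i))\<^sup>2)\<^sup>2 = l\<^sup>2 * T\<^sup>2"
    "real (card {1..k}) * (\<Sum>i=1..k. \<Sum>j=1..k. (e i \<bullet> e j)\<^sup>2) = l\<^sup>2 * (real k * G)"
    unfolding trace_e frob_e by (simp_all add: power_mult_distrib)
  have k_le: "T\<^sup>2 \<le> real k * G"
    using gram_inequality[of "{1..k}" e] \<open>l > 0\<close> unfolding gram_e by simp
  have k_eq: "T\<^sup>2 = real k * G \<longleftrightarrow>
      (\<forall>i\<in>{1..k}. \<forall>j\<in>{1..k}. i \<noteq> j \<longrightarrow> orthogonal (e i) (e j)) \<and>
      (\<forall>i\<in>{1..k}. \<forall>j\<in>{1..k}. norm (e i) = norm (e j))"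
    using gram_equality_iff[of "{1..k}" e] \<open>l > 0\<close> unfolding gram_e by simp
  have M_le: "T\<^sup>2 \<le> real M * G"
    using gram_inequality[of UNIV B] by (simp add: T_def G_def M_def)
  have M_eq: "T\<^sup>2 = real M * G \<longleftrightarrow>
      (\<forall>r s. r \<noteq> s \<longrightarrow> frob_inner (B r) (B s) = 0) \<and> (\<forall>r s. frob_norm (B r) = frob_norm (B s))"
    using gram_equality_iff[of UNIV B]
    by (simp add: T_def G_def M_def frob_inner_eq_inner frob_norm_eq_norm orthogonal_def)
  \<comment> \<open>\<open>k_le\<close> and \<open>M_le\<close> hold whatever the order of
    \<open>k\<close> and \<open>M\<close>, hence so does the estimate with the minimum; equality is
    then decided by the family whose size attains it.\<close>
  have "lhs \<le> rhs (min k M)"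
    using le_iff[of "min k M"] k_le M_le \<open>k > 0\<close> \<open>M > 0\<close> by (simp add: min_def)
  moreover have "k \<le> M \<longrightarrow> (lhs = rhs (min k M) \<longleftrightarrow>
      (\<forall>i\<in>{1..k}. \<forall>j\<in>{1..k}. i \<noteq> j \<longrightarrow> orthogonal (e i) (e j)) \<and>
      (\<forall>i\<in>{1..k}. \<forall>j\<in>{1..k}. norm (e i) = norm (e j)))"
    unfolding k_eq[symmetric] using eq_iff[OF \<open>k > 0\<close>] by (simp add: min_absorb1)
  moreover have "M \<le> k \<longrightarrow> (lhs = rhs (min k M) \<longleftrightarrow>
      (\<forall>r s. r \<noteq> s \<longrightarrow> frob_inner (B r) (B s) = 0) \<and> (\<forall>r s. frob_norm (B r) = frob_norm (B s)))"
    unfolding M_eq[symmetric] using eq_iff[OF \<open>M > 0\<close>] by (simp add: min_absorb2)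
  ultimately show ?thesis
    unfolding Let_def e_def lhs_def rhs_def k_def M_def by (intro conjI)
qed

end
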